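(* Every ($2K_2$, triangle)-free graph $G$ on $n$ vertices is recolorable, and the diameter of $R_\ell(G)$ is at most $2n^2$ for all $\ell\ge\chi(G)+1$.
   Context: All graphs are finite and simple. A $k$-coloring of $G$ is a map $V(G)\to\{1,\dots,k\}$ giving adjacent vertices different values; $\chi(G)$ is the chromatic number. $R_k(G)$ denotes the graph whose vertices are the $k$-colorings of $G$, two being adjacent if they differ in color on exactly one vertex. $G$ is recolorable if $R_\ell(G)$ is connected for all $\ell\ge\chi(G)+1$. A graph is $(H_1,H_2)$-free if it has no induced subgraph isomorphic to $H_1$ or $H_2$. $2K_2$ is the disjoint union of two edges; the triangle is $K_3$. *)

theory Defs
  imports "Graph_Theory.Graph_Theory" "HOL-Library.FuncSet" "HOL-Library.Extended_Real"
begin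

text \<open>
  A finite simple graph is a \<^locale>\<open>pair_graph\<close>: each undirected edge is stored as the two
  ordered pairs of its ends.
\<close>

definition induced_free :: "'b pair_pre_digraph \<Rightarrow> 'a pair_pre_digraph \<Rightarrow> bool" where
  "induced_free H G \<longleftrightarrow>
     \<not> (\<exists>S. induced_subgraph S (with_proj G) \<and> digraph_iso S (with_proj H))"

definition two_K2 :: "nat pair_pre_digraph" where
  "two_K2 = \<lparr> pverts = {0, 1, 2, 3}, parcs = {(0, 1), (1, 0), (2, 3), (3, 2)} \<rparr>"

definition triangle_graph :: "nat pair_pre_digraph" where
  "triangle_graph = \<lparr> pverts = {0, 1, 2}, parcs = {(0, 1), (1, 0), (0, 2), (2, 0), (1, 2), (2, 1)} \<rparr>"

text \<open>
  Colorings are extensional functions, so that two colorings are equal as soon as they agree on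
  the vertices.
\<close>

definition colorings :: "nat \<Rightarrow> 'a pair_pre_digraph \<Rightarrow> ('a \<Rightarrow> nat) set" where
  "colorings k G = {c \<in> pverts G \<rightarrow>\<^sub>E {1..k}. \<forall>(u, v) \<in> parcs G. c u \<noteq> c v}"

definition chromatic_number :: "'a pair_pre_digraph \<Rightarrow> nat" where
  "chromatic_number G = (LEAST k. colorings k G \<noteq> {})"

definition recoloring_graph :: "nat \<Rightarrow> 'a pair_pre_digraph \<Rightarrow> ('a \<Rightarrow> nat) pair_pre_digraph" where
  "recoloring_graph k G =
     \<lparr> pverts = colorings k G,
       parcs = {(c, d). c \<in> colorings k G \<and> d \<in> colorings k G \<and>
                        card {v \<in> pverts G. c v \<noteq> d v} = 1} \<rparr>"

definition recolorable :: "'a pair_pre_digraph \<Rightarrow> bool" where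
  "recolorable G \<longleftrightarrow>
     (\<forall>l \<ge> chromatic_number G + 1. Digraph_Component.connected (with_proj (recoloring_graph l G)))"

text \<open>
  With unit arc weights, \<^const>\<open>wf_digraph.\<mu>\<close> is the length of a shortest walk, and \<open>\<infinity>\<close> if there is
  none. The diameter of the graph without vertices is the supremum of the empty set, \<open>- \<infinity>\<close>;
  lemma \<open>colorings_nonempty\<close> excludes this case for the recoloring graphs of interest.
\<close>

definition graph_diameter :: "'a pair_pre_digraph \<Rightarrow> ereal" where
  "graph_diameter G = (SUP u \<in> pverts G. SUP v \<in> pverts G. wf_digraph.\<mu> (with_proj G) (\<lambda>_. 1) u v)"

lemma pair_graph_two_K2: "pair_graph two_K2"
  by unfold_locales (auto simp: two_K2_def symmetric_def intro!: symI)

lemma complete_digraph_triangle_graph: "complete_digraph 3 (with_proj triangle_graph)"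
  unfolding complete_digraph_pair_def by (auto simp: triangle_graph_def)

lemma pair_graph_recoloring_graph:
  assumes "pair_graph G"
  shows "pair_graph (recoloring_graph k G)"
proof -
  interpret pair_graph G by fact
  have "finite (colorings k G)"
    by (rule finite_subset[of _ "pverts G \<rightarrow>\<^sub>E {1..k}"])
       (auto simp: colorings_def intro!: finite_PiE pair_finite_verts)
  moreover from this have "finite (parcs (recoloring_graph k G))"
    by (auto simp: recoloring_graph_def intro: finite_subset[of _ "colorings k G \<times> colorings k G"])
  moreover have "sym (parcs (recoloring_graph k G))"
  proof (rule symI)
    fix c d assume "(c, d) \<in> parcs (recoloring_graph k G)"
    moreover have "{v \<in> pverts G. d v \<noteq> c v} = {v \<in> pverts G. c v \<noteq> d v}" by auto
    ultimately show "(d, c) \<in> parcs (recoloring_graph k G)"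
      by (simp add: recoloring_graph_def)
  qed
  ultimately show ?thesis
    by unfold_locales (auto simp: recoloring_graph_def symmetric_def)
qed

lemma colorings_nonempty:
  assumes "pair_graph G" and "k \<ge> chromatic_number G"
  shows "colorings k G \<noteq> {}"
proof -
  interpret pair_graph G by fact
  obtain f where f: "bij_betw f (pverts G) {1..card (pverts G)}"
    using finite_same_card_bij[OF pair_finite_verts, of "{1..card (pverts G)}"] by auto
  have "restrict f (pverts G) \<in> colorings (card (pverts G)) G"
    using f pair_no_loops wellformed'
    by (fastforce simp: colorings_def bij_betw_def dest: inj_onD)
  then have "colorings (card (pverts G)) G \<noteq> {}" by blast
  then have "colorings (chromatic_number G) G \<noteq> {}"
    unfolding chromatic_number_def by (rule LeastI)
  moreover have "colorings (chromatic_number G) G \<subseteq> colorings k G"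
    using assms(2) unfolding colorings_def
    by (auto simp: PiE_iff)
  ultimately show ?thesis by blast
qed

end

theory Submission
  imports Defs
begin

text \<open>
  By induction on \<open>|V|\<close>, any two colorings are joined by a sequence that recolors each vertex at
  most \<open>2|V|\<close> times. If \<open>u\<close> and \<open>v\<close> are nonadjacent and \<open>N(u) \<subseteq> N(v)\<close>, give \<open>u\<close> the color of \<open>v\<close>,
  let \<open>u\<close> follow \<open>v\<close> through a sequence for \<open>V - {u}\<close>, and finally repair the color of \<open>u\<close>: this
  recolors \<open>u\<close> only two more times than \<open>v\<close>. If no such pair exists, two nonadjacent vertices
  have incomparable neighbourhoods, which \<open>2K\<^sub>2\<close>-freeness extends to an induced \<open>P\<^sub>4\<close> and then to
  a \<open>C\<^sub>5\<close>; any further vertex would be comparable to a vertex of the cycle. So the graph is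
  empty, \<open>K\<^sub>1\<close>, \<open>K\<^sub>2\<close> or \<open>C\<^sub>5\<close>. These are built up one vertex at a time: a new vertex with at
  most \<open>k - 2\<close> neighbours only has to move out of the way when a neighbour takes its color, which
  adds up to \<open>1, 2, 3, 4, 6\<close> recolorings along \<open>C\<^sub>5\<close>.
\<close>

section \<open>Recoloring sequences in a graph given by its adjacency relation\<close>

locale simple_graph =
  fixes adj :: "'a \<Rightarrow> 'a \<Rightarrow> bool" (infix "\<sim>" 50)
  assumes adj_sym: "x \<sim> y \<Longrightarrow> y \<sim> x"
    and adj_irrefl: "\<not> x \<sim> x"
begin

text \<open>Values outside \<open>V\<close> are free, so one function serves as a coloring of
  \<open>V\<close> and of every subset of \<open>V\<close> when vertices are removed or
  added.\<close>

definition proper :: "nat \<Rightarrow> 'a set \<Rightarrow> ('a \<Rightarrow> nat) \<Rightarrow> bool" where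
  "proper k V c \<longleftrightarrow> (\<forall>v\<in>V. c v \<in> {1..k}) \<and> (\<forall>v\<in>V. \<forall>w\<in>V. v \<sim> w \<longrightarrow> c v \<noteq> c w)"

text \<open>The new colors are not recorded, since only the number of entries per vertex is counted
  later. The coloring reached by a step is proper because the rest of the sequence starts with
  it.\<close>

inductive recoloring :: "nat \<Rightarrow> 'a set \<Rightarrow> ('a \<Rightarrow> nat) \<Rightarrow> 'a list \<Rightarrow> ('a \<Rightarrow> nat) \<Rightarrow> bool"
  for k V where
  Nil: "proper k V c \<Longrightarrow> recoloring k V c [] c"
| Cons: "proper k V c \<Longrightarrow> v \<in> V \<Longrightarrow> recoloring k V (c(v := x)) vs d \<Longrightarrow>
    recoloring k V c (v # vs) d"

text \<open>A listed vertex may keep its color, so the list bounds the number of recolorings from above.\<close>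

definition recolorable_within :: "nat \<Rightarrow> 'a set \<Rightarrow> ('a \<Rightarrow> nat) \<Rightarrow> bool" where
  "recolorable_within k V g \<longleftrightarrow>
    (\<forall>c d. proper k V c \<longrightarrow> proper k V d \<longrightarrow> (\<forall>w. w \<notin> V \<longrightarrow> c w = d w) \<longrightarrow>
      (\<exists>vs. recoloring k V c vs d \<and> (\<forall>w\<in>V. count_list vs w \<le> g w)))"

lemma recolorable_withinI:
  assumes "\<And>c d. proper k V c \<Longrightarrow> proper k V d \<Longrightarrow> (\<And>w. w \<notin> V \<Longrightarrow> c w = d w) \<Longrightarrow>
    \<exists>vs. recoloring k V c vs d \<and> (\<forall>w\<in>V. count_list vs w \<le> g w)"
  shows "recolorable_within k V g"
  using assms unfolding recolorable_within_def by blast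

lemma recolorable_within_mono:
  "recolorable_within k V g \<Longrightarrow> (\<And>v. v \<in> V \<Longrightarrow> g v \<le> h v) \<Longrightarrow> recolorable_within k V h"
  unfolding recolorable_within_def by (meson order_trans)

lemma recolorable_within_empty: "recolorable_within k {} g"
  by (rule recolorable_withinI) (metis recoloring.Nil ext empty_iff)

lemma recoloring_proper: "recoloring k V c vs d \<Longrightarrow> proper k V c"
  by (cases rule: recoloring.cases) auto

lemma recoloring_set: "recoloring k V c vs d \<Longrightarrow> set vs \<subseteq> V"
  by (induction rule: recoloring.induct) auto

lemma recoloring_snoc:
  "recoloring k V c vs d \<Longrightarrow> v \<in> V \<Longrightarrow> proper k V (d(v := x)) \<Longrightarrow>
    recoloring k V c (vs @ [v]) (d(v := x))"
  by (induction rule: recoloring.induct) (auto intro: recoloring.intros)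

lemma proper_mono: "proper k V c \<Longrightarrow> U \<subseteq> V \<Longrightarrow> proper k U c"
  unfolding proper_def by blast

lemma proper_fun_upd_outside: "u \<notin> V \<Longrightarrow> proper k V (c(u := x)) \<longleftrightarrow> proper k V c"
  unfolding proper_def by auto

lemma proper_insert:
  assumes "u \<notin> V"
  shows "proper k (insert u V) (c(u := x)) \<longleftrightarrow>
    proper k V c \<and> x \<in> {1..k} \<and> (\<forall>z\<in>V. z \<sim> u \<longrightarrow> c z \<noteq> x)"
  using assms unfolding proper_def by (auto simp: adj_irrefl dest: adj_sym)

section \<open>Adding a dominated vertex\<close>

lemma proper_dominated:
  assumes "proper k V c" "u \<notin> V" "v \<in> V" and "\<And>z. z \<in> V \<Longrightarrow> z \<sim> u \<Longrightarrow> z \<sim> v"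
  shows "proper k (insert u V) (c(u := c v))"
  unfolding proper_insert[OF assms(2)] using assms unfolding proper_def by blast

text \<open>\<open>u\<close> copies \<open>v\<close>: whenever \<open>v\<close> is about to take a
  color, \<open>u\<close> takes it first. This is safe because the neighbours of \<open>u\<close> in
  \<open>V\<close> are neighbours of \<open>v\<close> and so avoid that color.\<close>

lemma recoloring_dominated:
  assumes "recoloring k V c vs d" "u \<notin> V" "v \<in> V" "\<not> u \<sim> v"
    and dom: "\<And>z. z \<in> V \<Longrightarrow> z \<sim> u \<Longrightarrow> z \<sim> v"
  shows "\<exists>ws. recoloring k (insert u V) (c(u := c v)) ws (d(u := d v)) \<and>
    (\<forall>w. w \<noteq> u \<longrightarrow> count_list ws w = count_list vs w) \<and> count_list ws u = count_list vs v"
  using assms(1)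
proof (induction rule: recoloring.induct)
  case (Nil c)
  have "proper k (insert u V) (c(u := c v))"
    using Nil assms(2,3) dom by (rule proper_dominated)
  then have "recoloring k (insert u V) (c(u := c v)) [] (c(u := c v))"
    by (rule recoloring.Nil)
  then show ?case by (intro exI[of _ "[]"]) (simp del: fun_upd_apply)
next
  case (Cons c w x vs d)
  have wu: "w \<noteq> u" using Cons.hyps assms(2) by auto
  have P: "proper k (insert u V) (c(u := c v))"
    using Cons.hyps(1) assms(2,3) dom by (rule proper_dominated)
  from Cons.IH obtain ws where ws:
    "recoloring k (insert u V) ((c(w := x))(u := (c(w := x)) v)) ws (d(u := d v))"
    "\<forall>w. w \<noteq> u \<longrightarrow> count_list ws w = count_list vs w" "count_list ws u = count_list vs v"
    by blast
  show ?case
  proof (cases "w = v")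
    case False
    have "(c(w := x))(u := (c(w := x)) v) = (c(u := c v))(w := x)"
      using wu False by (auto simp: fun_eq_iff)
    then have "recoloring k (insert u V) (c(u := c v)) (w # ws) (d(u := d v))"
      using ws(1) P Cons.hyps by (auto intro!: recoloring.Cons[where x = x])
    then show ?thesis using ws(2,3) wu False by (intro exI[of _ "w # ws"]) (auto simp del: fun_upd_apply)
  next
    case True
    have eq: "(c(w := x))(u := (c(w := x)) v) = ((c(u := c v))(u := x))(w := x)"
      using wu True by (auto simp: fun_eq_iff)
    have x: "proper k V (c(v := x))" using recoloring_proper[OF Cons.hyps(3)] True by simp
    \<comment> \<open>In the coloring between the two moves, \<open>v\<close> has its old color and
      \<open>u\<close> already the new one.\<close>
    have "proper k (insert u V) (c(u := x))"
      unfolding proper_insert[OF assms(2)]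
    proof (intro conjI ballI impI)
      show "proper k V c" by fact
      show "x \<in> {1..k}" using x assms(3) unfolding proper_def by (metis fun_upd_same)
      fix z assume z: "z \<in> V" "z \<sim> u"
      then have "z \<sim> v" by (rule dom)
      then have "z \<noteq> v" using adj_irrefl by auto
      then show "c z \<noteq> x" using x z(1) assms(3) \<open>z \<sim> v\<close> unfolding proper_def
        by (metis fun_upd_same fun_upd_other)
    qed
    then have "recoloring k (insert u V) (c(u := x)) (w # ws) (d(u := d v))"
      using ws(1) Cons.hyps(2) unfolding eq by (auto intro!: recoloring.Cons[where x = x])
    then have "recoloring k (insert u V) (c(u := c v)) (u # w # ws) (d(u := d v))"
      using P by (auto intro!: recoloring.Cons[where x = x and v = u])
    then show ?thesis using ws(2,3) wu True by (intro exI[of _ "u # w # ws"]) (auto simp del: fun_upd_apply)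
  qed
qed

text \<open>The 2 in the condition on \<open>g\<close> pays for the first move of \<open>u\<close>,
  onto the color of \<open>v\<close>, and for the last one, onto its target color.\<close>

lemma recolorable_within_dominated:
  assumes R: "recolorable_within k V g" and uv: "u \<notin> V" "v \<in> V" "\<not> u \<sim> v"
    and dom: "\<And>z. z \<in> V \<Longrightarrow> z \<sim> u \<Longrightarrow> z \<sim> v"
    and g: "g v + 2 \<le> g u"
  shows "recolorable_within k (insert u V) g"
proof (rule recolorable_withinI)
  fix c d
  assume c: "proper k (insert u V) c" and d: "proper k (insert u V) d"
    and out: "\<And>w. w \<notin> insert u V \<Longrightarrow> c w = d w"
  \<comment> \<open>The assumption on \<open>V\<close> only joins colorings that agree outside
    \<open>V\<close>, so the target is given the value \<open>c u\<close> at
    \<open>u\<close>.\<close>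
  have "proper k V c" "proper k V (d(u := c u))"
    using c d uv(1) by (auto simp: proper_fun_upd_outside intro: proper_mono)
  moreover have "\<forall>w. w \<notin> V \<longrightarrow> c w = (d(u := c u)) w" using out by auto
  ultimately obtain vs where vs: "recoloring k V c vs (d(u := c u))"
    "\<forall>w\<in>V. count_list vs w \<le> g w"
    using R unfolding recolorable_within_def by blast
  have "u \<noteq> v" using uv by auto
  with recoloring_dominated[OF vs(1) uv dom] obtain ws where ws:
    "recoloring k (insert u V) (c(u := c v)) ws (d(u := d v))"
    "\<forall>w. w \<noteq> u \<longrightarrow> count_list ws w = count_list vs w" "count_list ws u = count_list vs v"
    by auto
  have "recoloring k (insert u V) c (u # ws) (d(u := d v))"
    using c ws(1) by (auto intro!: recoloring.Cons)
  then have "recoloring k (insert u V) c ((u # ws) @ [u]) ((d(u := d v))(u := d u))"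
    by (rule recoloring_snoc) (use d in auto)
  then have "recoloring k (insert u V) c (u # ws @ [u]) d" by simp
  moreover have "count_list (u # ws @ [u]) w \<le> g w" if "w \<in> insert u V" for w
    using that vs(2) ws(2,3) uv g by fastforce
  ultimately show "\<exists>vs. recoloring k (insert u V) c vs d \<and>
      (\<forall>w\<in>insert u V. count_list vs w \<le> g w)" by blast
qed

section \<open>Adding a vertex of low degree\<close>

text \<open>\<open>u\<close> moves only when a neighbour is about to take its color, so each move of
  \<open>u\<close> is charged to an entry of a vertex of \<open>N\<close>. Its final color
  \<open>y'\<close> is whatever these moves lead to.\<close>

lemma recoloring_low_degree:
  assumes "recoloring k V c vs d" "u \<notin> V" "finite N"
    and N: "\<And>z. z \<in> V \<Longrightarrow> z \<sim> u \<Longrightarrow> z \<in> N" and k: "card N + 2 \<le> k"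
    and "proper k (insert u V) (c(u := y))"
  shows "\<exists>ws y'. recoloring k (insert u V) (c(u := y)) ws (d(u := y')) \<and>
    (\<forall>w. w \<noteq> u \<longrightarrow> count_list ws w = count_list vs w) \<and>
    count_list ws u \<le> sum (count_list vs) N"
  using assms(1,6)
proof (induction arbitrary: y rule: recoloring.induct)
  case (Nil c)
  then show ?case by (intro exI[of _ "[]"] exI[of _ y]) (auto intro: recoloring.Nil)
next
  case (Cons c w x vs d)
  have wu: "w \<noteq> u" using Cons.hyps assms(2) by auto
  have x: "proper k V (c(w := x))" using recoloring_proper[OF Cons.hyps(3)] .
  have sum_le: "sum (count_list vs) N \<le> sum (count_list (w # vs)) N"
    by (rule sum_mono) auto
  have swap: "(c(w := x))(u := y) = (c(u := y))(w := x)" for y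
    using wu by (auto simp: fun_eq_iff)
  show ?case
  proof (cases "w \<sim> u \<and> x = y")
    case False
    have "proper k (insert u V) ((c(w := x))(u := y))"
      using Cons.prems x False unfolding proper_insert[OF assms(2)] by auto
    from Cons.IH[OF this] obtain ws y' where ws:
      "recoloring k (insert u V) ((c(w := x))(u := y)) ws (d(u := y'))"
      "\<forall>w. w \<noteq> u \<longrightarrow> count_list ws w = count_list vs w"
      "count_list ws u \<le> sum (count_list vs) N" by blast
    have "recoloring k (insert u V) (c(u := y)) (w # ws) (d(u := y'))"
      by (rule recoloring.Cons[where x = x])
        (use ws(1) Cons.prems Cons.hyps(2) swap in \<open>simp_all del: fun_upd_apply\<close>)
    then show ?thesis using ws(2,3) wu sum_le
      by (intro exI[of _ "w # ws"] exI[of _ y']) (auto simp del: fun_upd_apply)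
  next
    case True
    have wN: "w \<in> N" using True N Cons.hyps(2) by blast
    \<comment> \<open>The colors on \<open>N\<close> together with \<open>x\<close> are at most
      \<open>k - 1\<close> values, so some color is free for \<open>u\<close> both before and after
      the move of \<open>w\<close>.\<close>
    have "card (insert x (c ` N)) < card {1..k}"
      using k card_image_le[OF assms(3), of c] card_insert_le_m1[of "Suc (card N)" "c ` N" x]
      by auto
    then have "\<not> {1..k} \<subseteq> insert x (c ` N)"
      using card_mono[of "insert x (c ` N)" "{1..k}"] assms(3) by auto
    then obtain y2 where y2: "y2 \<in> {1..k}" "y2 \<noteq> x" "y2 \<notin> c ` N" by blast
    have P: "proper k (insert u V) (c(u := y2))"
      using Cons.hyps(1) y2 N unfolding proper_insert[OF assms(2)] by auto
    have "proper k (insert u V) ((c(w := x))(u := y2))"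
      using x y2 N unfolding proper_insert[OF assms(2)] by auto
    from Cons.IH[OF this] obtain ws y' where ws:
      "recoloring k (insert u V) ((c(w := x))(u := y2)) ws (d(u := y'))"
      "\<forall>w. w \<noteq> u \<longrightarrow> count_list ws w = count_list vs w"
      "count_list ws u \<le> sum (count_list vs) N" by blast
    have ws2: "recoloring k (insert u V) (c(u := y2)) (w # ws) (d(u := y'))"
      by (rule recoloring.Cons[where x = x])
        (use ws(1) P Cons.hyps(2) swap in \<open>simp_all del: fun_upd_apply\<close>)
    have "recoloring k (insert u V) (c(u := y)) (u # w # ws) (d(u := y'))"
      by (rule recoloring.Cons[where x = y2]) (use ws2 Cons.prems in \<open>simp_all del: fun_upd_apply\<close>)
    \<comment> \<open>As \<open>w\<close> lies in \<open>N\<close>, its entry raises the sum by one,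
      which pays for the extra move of \<open>u\<close>.\<close>
    moreover have "Suc (sum (count_list vs) N) \<le> sum (count_list (w # vs)) N"
      unfolding Suc_le_eq by (rule sum_strict_mono_ex1[OF assms(3)]) (use wN in auto)
    ultimately show ?thesis using ws(2,3) wu
      by (intro exI[of _ "u # w # ws"] exI[of _ y']) (auto simp del: fun_upd_apply)
  qed
qed

text \<open>The bound on \<open>g u\<close> is strict because \<open>u\<close> is recolored once
  more at the end, to reach its target color.\<close>

lemma recolorable_within_low_degree:
  assumes R: "recolorable_within k V g" and u: "u \<notin> V" and N: "finite N" "N \<subseteq> V"
    and nb: "\<And>z. z \<in> V \<Longrightarrow> z \<sim> u \<Longrightarrow> z \<in> N" and k: "card N + 2 \<le> k"
    and g: "sum g N < g u"
  shows "recolorable_within k (insert u V) g"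
proof (rule recolorable_withinI)
  fix c d
  assume c: "proper k (insert u V) c" and d: "proper k (insert u V) d"
    and out: "\<And>w. w \<notin> insert u V \<Longrightarrow> c w = d w"
  have "proper k V c" "proper k V (d(u := c u))"
    using c d u by (auto simp: proper_fun_upd_outside intro: proper_mono)
  moreover have "\<forall>w. w \<notin> V \<longrightarrow> c w = (d(u := c u)) w" using out by auto
  ultimately obtain vs where vs: "recoloring k V c vs (d(u := c u))"
    "\<forall>w\<in>V. count_list vs w \<le> g w"
    using R unfolding recolorable_within_def by blast
  have "proper k (insert u V) (c(u := c u))" using c by simp
  from recoloring_low_degree[OF vs(1) u N(1) nb k this] obtain ws y where ws:
    "recoloring k (insert u V) c ws (d(u := y))"
    "\<forall>w. w \<noteq> u \<longrightarrow> count_list ws w = count_list vs w"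
    "count_list ws u \<le> sum (count_list vs) N" by auto
  have "recoloring k (insert u V) c (ws @ [u]) ((d(u := y))(u := d u))"
    using ws(1) by (rule recoloring_snoc) (use d in auto)
  then have "recoloring k (insert u V) c (ws @ [u]) d" by simp
  moreover have "sum (count_list vs) N \<le> sum g N"
    using vs(2) N(2) by (intro sum_mono) auto
  then have "count_list (ws @ [u]) w \<le> g w" if "w \<in> insert u V" for w
    using that vs(2) ws(2,3) g u by (cases "w = u") auto
  ultimately show "\<exists>vs. recoloring k (insert u V) c vs d \<and>
      (\<forall>w\<in>insert u V. count_list vs w \<le> g w)" by blast
qed

end

section \<open>Structure of graphs without triangles and induced \<open>2K_2\<close>\<close>

text \<open>If the two edges in \<open>no_two_K2\<close> share an end, its conclusion holds by
  symmetry, so it constrains disjoint edges only.\<close>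

locale two_K2_triangle_free = simple_graph +
  assumes no_triangle: "x \<sim> y \<Longrightarrow> y \<sim> z \<Longrightarrow> \<not> x \<sim> z"
    and no_two_K2: "a \<sim> b \<Longrightarrow> c \<sim> d \<Longrightarrow> a \<sim> c \<or> a \<sim> d \<or> b \<sim> c \<or> b \<sim> d"
begin

text \<open>A closed walk of length 5. Without triangles it repeats no vertex and has no chord, so
  it is an induced cycle.\<close>

definition five_cycle :: "'a \<Rightarrow> 'a \<Rightarrow> 'a \<Rightarrow> 'a \<Rightarrow> 'a \<Rightarrow> bool" where
  "five_cycle a b c d e \<longleftrightarrow> a \<sim> b \<and> b \<sim> c \<and> c \<sim> d \<and> d \<sim> e \<and> e \<sim> a"

lemma five_cycle_rotate: "five_cycle a b c d e \<Longrightarrow> five_cycle b c d e a"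
  unfolding five_cycle_def by blast

lemma five_cycle_distinct: "five_cycle a b c d e \<Longrightarrow> distinct [a, b, c, d, e]"
  unfolding five_cycle_def using adj_sym adj_irrefl no_triangle
  by (simp (no_asm)) (intro conjI; metis)

text \<open>Apply \<open>no_two_K2\<close> to the edges \<open>v a\<close> and \<open>c d\<close>: a
  chord from \<open>a\<close> to \<open>c\<close> or \<open>d\<close> would close a
  triangle.\<close>

lemma five_cycle_neighbour:
  assumes "five_cycle a b c d e" and v: "v \<sim> a"
  shows "v \<sim> c \<or> v \<sim> d"
  using assms(1) no_two_K2[of v a c d] v unfolding five_cycle_def
  using adj_sym no_triangle by blast

text \<open>If \<open>v\<close> missed the cycle, then \<open>w\<close> would have to meet all five edges of the cycle, hence
  be adjacent to both ends of one of them.\<close>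

lemma five_cycle_hit:
  assumes C: "five_cycle a b c d e" and vw: "v \<sim> w"
  shows "v \<sim> a \<or> v \<sim> b \<or> v \<sim> c \<or> v \<sim> d \<or> v \<sim> e"
proof (rule ccontr)
  assume "\<not> ?thesis"
  then have "w \<sim> a \<or> w \<sim> b" "w \<sim> b \<or> w \<sim> c" "w \<sim> c \<or> w \<sim> d" "w \<sim> d \<or> w \<sim> e" "w \<sim> e \<or> w \<sim> a"
    using no_two_K2[OF vw] C unfolding five_cycle_def by blast+
  then show False
    using C no_triangle adj_sym unfolding five_cycle_def by metis
qed

text \<open>\<open>v\<close> sees the same cycle vertices as \<open>a\<close>; the point is that
  \<open>a\<close> then dominates \<open>v\<close>. A neighbour \<open>w\<close> of \<open>v\<close>
  misses \<open>b\<close> and \<open>e\<close>, so if it missed \<open>a\<close> it would hit the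
  cycle in \<open>c\<close> or \<open>d\<close>, and \<open>five_cycle_neighbour\<close> forces a
  further neighbour among \<open>a\<close>, \<open>b\<close>, \<open>e\<close>.\<close>

lemma five_cycle_twin:
  assumes C: "five_cycle a b c d e" and v: "v \<sim> b" "v \<sim> e" and w: "v \<sim> w"
  shows "w \<sim> a"
proof (rule ccontr)
  assume "\<not> w \<sim> a"
  moreover have "\<not> w \<sim> b" "\<not> w \<sim> e" using v w no_triangle adj_sym by blast+
  ultimately have "w \<sim> c \<or> w \<sim> d" using five_cycle_hit[OF C adj_sym[OF w]] by blast
  moreover have "w \<sim> c \<Longrightarrow> w \<sim> e \<or> w \<sim> a"
    using five_cycle_neighbour[of c d e a b w] C unfolding five_cycle_def by blast
  moreover have "w \<sim> d \<Longrightarrow> w \<sim> a \<or> w \<sim> b"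
    using five_cycle_neighbour[of d e a b c w] C unfolding five_cycle_def by blast
  ultimately show False using \<open>\<not> w \<sim> a\<close> \<open>\<not> w \<sim> b\<close> \<open>\<not> w \<sim> e\<close> by blast
qed

lemma undominated_cases:
  assumes undom: "\<And>u v. u \<in> V \<Longrightarrow> v \<in> V \<Longrightarrow> u \<noteq> v \<Longrightarrow> \<not> u \<sim> v \<Longrightarrow> \<exists>x\<in>V. x \<sim> u \<and> \<not> x \<sim> v"
  obtains "V = {}" | x where "V = {x}" | x y where "V = {x, y}" "x \<sim> y"
    | a b c d e where "V = {a, b, c, d, e}" "five_cycle a b c d e"
proof (cases "\<exists>u\<in>V. \<exists>w\<in>V. u \<noteq> w \<and> \<not> u \<sim> w")
  case False
  then have adj: "x \<sim> y" if "x \<in> V" "y \<in> V" "x \<noteq> y" for x y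
    using that by blast
  show ?thesis
  proof (cases "\<exists>x\<in>V. \<exists>y\<in>V. x \<noteq> y")
    case True
    then obtain x y where xy: "x \<in> V" "y \<in> V" "x \<noteq> y" by blast
    have "z = x \<or> z = y" if "z \<in> V" for z
      using no_triangle[of x y z] adj xy that by metis
    then have "V = {x, y}" using xy by blast
    then show ?thesis using that(3) adj xy by blast
  next
    case False
    then have "V = {} \<or> (\<exists>x. V = {x})" by blast
    then show ?thesis using that(1,2) by blast
  qed
next
  case True
  then obtain u w where uw: "u \<in> V" "w \<in> V" "u \<noteq> w" "\<not> u \<sim> w" by blast
  \<comment> \<open>Each of \<open>u\<close> and \<open>w\<close> has a neighbour that the other
    lacks. \<open>no_two_K2\<close> joins these two, so \<open>u\<close>, \<open>a\<close>,
    \<open>b\<close>, \<open>w\<close> is an induced path.\<close>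
  obtain a where a: "a \<in> V" "a \<sim> u" "\<not> a \<sim> w" using undom[OF uw] by blast
  obtain b where b: "b \<in> V" "b \<sim> w" "\<not> b \<sim> u"
    using undom[of w u] uw adj_sym by blast
  have ab: "a \<sim> b" using no_two_K2[OF a(2) b(2)] a b uw adj_sym by blast
  \<comment> \<open>\<open>u\<close> and \<open>b\<close> are nonadjacent too; a neighbour of
    \<open>u\<close> missing \<open>b\<close> must meet \<open>w\<close> and closes the path to a
    5-cycle.\<close>
  obtain x where x: "x \<in> V" "x \<sim> u" "\<not> x \<sim> b"
    using undom[of u b] uw b a adj_sym by blast
  have xw: "x \<sim> w" using no_two_K2[OF x(2) b(2)] x b uw adj_sym by blast
  have C: "five_cycle x u a b w"
    unfolding five_cycle_def using x a b ab xw adj_sym by blast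
  \<comment> \<open>By \<open>five_cycle_twin\<close>, such a \<open>v\<close> is dominated by
    \<open>p\<close>, which \<open>undom\<close> allows only for \<open>v = p\<close>.\<close>
  have twin: "v = p" if C: "five_cycle p q r s t" and "p \<in> V" "v \<in> V" "v \<sim> q" "v \<sim> t" for p q r s t v
  proof (rule ccontr)
    assume "v \<noteq> p"
    have "\<not> v \<sim> p" using C that no_triangle adj_sym unfolding five_cycle_def by blast
    with undom[of v p] that \<open>v \<noteq> p\<close> obtain y where "y \<in> V" "y \<sim> v" "\<not> y \<sim> p" by blast
    then show False using five_cycle_twin[OF C] that adj_sym by blast
  qed
  \<comment> \<open>A second neighbour \<open>r\<close> or \<open>s\<close> on the cycle makes
    \<open>v\<close> a twin of \<open>q\<close> or of \<open>t\<close>.\<close>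
  have near: "v = q \<or> v = t"
    if C: "five_cycle p q r s t" and "q \<in> V" "t \<in> V" "v \<in> V" "v \<sim> p" for p q r s t v
  proof -
    have "v \<sim> r \<or> v \<sim> s" using five_cycle_neighbour[OF C] that by blast
    then show ?thesis
      using twin[of q r s t p v] twin[of t p q r s v] that unfolding five_cycle_def by blast
  qed
  note C1 = five_cycle_rotate[OF C]
  note C2 = five_cycle_rotate[OF C1]
  note C3 = five_cycle_rotate[OF C2]
  note C4 = five_cycle_rotate[OF C3]
  note in_V = x(1) uw(1,2) a(1) b(1)
  have "v \<in> {x, u, a, b, w}" if v: "v \<in> V" for v
  proof (rule ccontr)
    assume out: "v \<notin> {x, u, a, b, w}"
    have "\<not> v \<sim> x" using near[OF C, of v] out in_V v by blast
    \<comment> \<open>\<open>v\<close> is not isolated, since it is not dominated by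
      \<open>x\<close>; having no neighbour on the cycle, it then contradicts
      \<open>five_cycle_hit\<close>.\<close>
    moreover obtain z where "v \<sim> z" using undom[of v x] \<open>\<not> v \<sim> x\<close> out v x adj_sym by blast
    moreover have "\<not> v \<sim> u" using near[OF C1, of v] out in_V v by blast
    moreover have "\<not> v \<sim> a" using near[OF C2, of v] out in_V v by blast
    moreover have "\<not> v \<sim> b" using near[OF C3, of v] out in_V v by blast
    moreover have "\<not> v \<sim> w" using near[OF C4, of v] out in_V v by blast
    ultimately show False using five_cycle_hit[OF C \<open>v \<sim> z\<close>] by blast
  qed
  then have "V = {x, u, a, b, w}" using x(1) uw(1,2) a(1) b(1) by blast
  with C show ?thesis using that by blast
qed

section \<open>Recoloring bounds for the base graphs and the induction\<close>

lemma recolorable_within_five_cycle: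
  assumes C: "five_cycle a b c d e" and k: "4 \<le> k"
  shows "recolorable_within k {a, b, c, d, e} (\<lambda>_. 10)"
proof -
  \<comment> \<open>Each value is one more than the sum over the neighbours inserted earlier: one
    neighbour for each of \<open>b\<close>, \<open>c\<close>, \<open>d\<close>, and both
    \<open>a\<close> and \<open>d\<close> for \<open>e\<close>, whence \<open>1 + 4 + 1 = 6\<close>.
    These two neighbours of \<open>e\<close> are where \<open>4 \<le> k\<close> enters.\<close>
  define g where "g = (\<lambda>_. 0 :: nat)(a := 1, b := 2, c := 3, d := 4, e := 6)"
  have D: "a \<noteq> b" "a \<noteq> c" "a \<noteq> d" "a \<noteq> e" "b \<noteq> c" "b \<noteq> d" "b \<noteq> e" "c \<noteq> d" "c \<noteq> e" "d \<noteq> e"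
    using five_cycle_distinct[OF C] by auto
  have N: "\<not> a \<sim> c" "\<not> a \<sim> d" "\<not> b \<sim> d" "\<not> b \<sim> e" "\<not> c \<sim> e"
    using C no_triangle adj_sym unfolding five_cycle_def by blast+
  have "recolorable_within k {a} g"
    by (rule recolorable_within_low_degree[where N = "{}", OF recolorable_within_empty])
       (use k D g_def in auto)
  then have "recolorable_within k {b, a} g"
    by (rule recolorable_within_low_degree[where N = "{a}"]) (use k D N g_def in auto)
  then have "recolorable_within k {c, b, a} g"
    by (rule recolorable_within_low_degree[where N = "{b}"]) (use k D N g_def in auto)
  then have "recolorable_within k {d, c, b, a} g"
    by (rule recolorable_within_low_degree[where N = "{c}"]) (use k D N g_def in auto)
  then have "recolorable_within k {e, d, c, b, a} g"
    by (rule recolorable_within_low_degree[where N = "{d, a}"]) (use k D N g_def in auto)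
  moreover have "{e, d, c, b, a} = {a, b, c, d, e}" by auto
  moreover have "g v \<le> 10" for v using D by (auto simp: g_def)
  ultimately show ?thesis by (auto intro: recolorable_within_mono)
qed

text \<open>Odd cycles are not bipartite. One extra color then gives the 4 colors demanded by
  \<open>recolorable_within_five_cycle\<close>.\<close>

lemma five_cycle_three_colors:
  assumes C: "five_cycle a b c d e" and p: "proper k {a, b, c, d, e} f"
  shows "3 \<le> k"
proof (rule ccontr)
  assume "\<not> 3 \<le> k"
  have "f v = 1 \<or> f v = 2" if "v \<in> {a, b, c, d, e}" for v
  proof -
    have "f v \<in> {1..k}" using p that unfolding proper_def by blast
    with \<open>\<not> 3 \<le> k\<close> show ?thesis by auto
  qed
  moreover have "f a \<noteq> f b" "f b \<noteq> f c" "f c \<noteq> f d" "f d \<noteq> f e" "f e \<noteq> f a"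
    using p C unfolding proper_def five_cycle_def by auto
  ultimately show False by (metis insertCI)
qed

text \<open>The induction keeps \<open>k\<close> fixed: a \<open>k\<close>-coloring restricts to
  subsets, whereas their chromatic number may be smaller.\<close>

lemma recolorable_within_twice_card:
  assumes "finite V" and "proper k V f" and "1 \<le> k"
  shows "recolorable_within (Suc k) V (\<lambda>_. 2 * card V)"
  using assms(1,2)
proof (induction "card V" arbitrary: V rule: less_induct)
  case less
  show ?case
  proof (cases "\<exists>u\<in>V. \<exists>v\<in>V. u \<noteq> v \<and> \<not> u \<sim> v \<and> (\<forall>x\<in>V. x \<sim> u \<longrightarrow> x \<sim> v)")
    case True
    then obtain u v where uv: "u \<in> V" "v \<in> V" "u \<noteq> v" "\<not> u \<sim> v"
      and dom: "\<forall>x\<in>V. x \<sim> u \<longrightarrow> x \<sim> v" by blast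
    define W where "W = V - {u}"
    have W: "V = insert u W" "u \<notin> W" "finite W" "card V = Suc (card W)"
      using uv(1) less.prems(1) unfolding W_def
      by (auto simp: card_Suc_Diff1 simp del: card_Diff_insert card_Diff_singleton)
    \<comment> \<open>Removing \<open>u\<close> lowers \<open>2 * card V\<close> by exactly the 2
      that a dominated vertex costs.\<close>
    define g where "g = (\<lambda>_. 2 * card W)(u := 2 * card V)"
    have "recolorable_within (Suc k) W (\<lambda>_. 2 * card W)"
      using less W proper_mono[of k V f W] by auto
    then have "recolorable_within (Suc k) W g"
      by (rule recolorable_within_mono) (use W in \<open>auto simp: g_def\<close>)
    then have "recolorable_within (Suc k) (insert u W) g"
      by (rule recolorable_within_dominated[where v = v]) (use uv dom W in \<open>auto simp: g_def\<close>)
    then show ?thesis unfolding W(1)[symmetric]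
      by (rule recolorable_within_mono) (use W in \<open>auto simp: g_def\<close>)
  next
    case False
    then have undom: "\<And>u v. u \<in> V \<Longrightarrow> v \<in> V \<Longrightarrow> u \<noteq> v \<Longrightarrow> \<not> u \<sim> v \<Longrightarrow> \<exists>x\<in>V. x \<sim> u \<and> \<not> x \<sim> v"
      by blast
    show ?thesis
    proof (rule undominated_cases[OF undom])
      assume "V = {}"
      then show ?thesis by (simp add: recolorable_within_empty)
    next
      fix x assume "V = {x}"
      moreover have "recolorable_within (Suc k) {x} (\<lambda>_. 2)"
        by (rule recolorable_within_low_degree[where N = "{}", OF recolorable_within_empty])
           (use assms(3) in auto)
      ultimately show ?thesis by simp
    next
      fix x y assume V: "V = {x, y}" and xy: "x \<sim> y"
      have [simp]: "x \<noteq> y" "y \<noteq> x" using xy adj_irrefl by auto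
      \<comment> \<open>The edge uses two colors, so \<open>Suc k\<close> leaves room for one
        neighbour when \<open>x\<close> is added to \<open>{y}\<close>.\<close>
      have "2 \<le> k" using less.prems(2) xy unfolding V proper_def by fastforce
      have "recolorable_within (Suc k) {y} ((\<lambda>_. 1)(x := 2))"
        by (rule recolorable_within_low_degree[where N = "{}", OF recolorable_within_empty])
           (use assms(3) in auto)
      then have "recolorable_within (Suc k) {x, y} ((\<lambda>_. 1)(x := 2))"
        by (rule recolorable_within_low_degree[where N = "{y}"]) (use \<open>2 \<le> k\<close> in auto)
      then show ?thesis unfolding V
        by (rule recolorable_within_mono) auto
    next
      fix a b c d e assume V: "V = {a, b, c, d, e}" and C: "five_cycle a b c d e"
      have "card V = 5" using five_cycle_distinct[OF C] V by auto
      moreover have "3 \<le> k" using five_cycle_three_colors[OF C] less.prems(2) V by blast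
      ultimately show ?thesis using recolorable_within_five_cycle[OF C, of "Suc k"] V by simp
    qed
  qed
qed

end

section \<open>Transfer to \<open>pair_graph\<close>\<close>

text \<open>Arcs are pairs, so an injective vertex map that preserves and reflects arcs extends to
  them as \<open>map_prod f f\<close> and is an isomorphism onto the subgraph induced by its
  image.\<close>

lemma not_induced_freeI:
  assumes "pair_graph G" and "pair_graph H"
    and "inj_on f (pverts H)" and "f ` pverts H \<subseteq> pverts G"
    and arcs: "\<And>x y. x \<in> pverts H \<Longrightarrow> y \<in> pverts H \<Longrightarrow> (f x, f y) \<in> parcs G \<longleftrightarrow> (x, y) \<in> parcs H"
  shows "\<not> induced_free H G"
proof -
  interpret G: pair_graph G by fact
  interpret H: pair_graph H by fact
  define S where "S = with_proj G \<restriction> (f ` pverts H)"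
  have ind: "induced_subgraph S (with_proj G)"
    unfolding S_def using assms(4) G.induced_induce by simp
  define h where "h = \<lparr>iso_verts = f, iso_arcs = map_prod f f, iso_head = snd, iso_tail = fst\<rparr>"
  have "inj_on (map_prod f f) (pverts H \<times> pverts H)"
    using assms(3) by (simp add: map_prod_inj_on)
  then have inj: "inj_on (map_prod f f) (parcs H)"
    by (rule inj_on_subset) (use H.wellformed' in auto)
  have iso: "pre_digraph.digraph_isomorphism (with_proj H) h"
    using assms(3) inj H.wf_digraph_axioms unfolding pre_digraph.digraph_isomorphism_def
    by (auto simp: h_def wf_digraph_wp_iff)
  have "map_prod f f ` parcs H = {e \<in> parcs G. fst e \<in> f ` pverts H \<and> snd e \<in> f ` pverts H}"
    using arcs H.wellformed' by (force simp: image_iff)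
  then have "app_iso h (with_proj H) = S"
    unfolding app_iso_def S_def induce_subgraph_def h_def by simp
  then have "digraph_iso (with_proj H) S" using iso unfolding digraph_iso_def by blast
  then have "digraph_iso S (with_proj H)"
    using H.wf_digraph_axioms by (rule digraph_iso_swap[rotated])
  with ind show ?thesis unfolding induced_free_def by blast
qed

lemma two_K2_triangle_free_parcs:
  assumes G: "pair_graph G" and "induced_free two_K2 G" and "induced_free triangle_graph G"
  shows "two_K2_triangle_free (\<lambda>x y. (x, y) \<in> parcs G)"
proof -
  interpret pair_graph G by fact
  have S: "(y, x) \<in> parcs G" if "(x, y) \<in> parcs G" for x y
    using that by (rule arcs_symmetric)
  have T: "pair_graph triangle_graph"
    by unfold_locales (auto simp: triangle_graph_def symmetric_def intro!: symI)
  have L: "(x, x) \<notin> parcs G" for x using pair_no_loops[of "(x, x)"] by auto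
  note W = wellformed'
  show ?thesis
  proof unfold_locales
    fix x y z
    assume xy: "(x, y) \<in> parcs G" and yz: "(y, z) \<in> parcs G"
    show "(x, z) \<notin> parcs G"
    proof
      assume xz: "(x, z) \<in> parcs G"
      have "\<not> induced_free triangle_graph G"
        by (rule not_induced_freeI[OF G T, where f = "\<lambda>i. [x, y, z] ! i"])
           (use xy yz xz S L W in \<open>auto simp: triangle_graph_def inj_on_def\<close>)
      with assms(3) show False by blast
    qed
  next
    fix a b c d
    assume ab: "(a, b) \<in> parcs G" and cd: "(c, d) \<in> parcs G"
    show "(a, c) \<in> parcs G \<or> (a, d) \<in> parcs G \<or> (b, c) \<in> parcs G \<or> (b, d) \<in> parcs G"
    proof (rule ccontr)
      assume "\<not> ?thesis"
      then have non: "(a, c) \<notin> parcs G" "(a, d) \<notin> parcs G" "(b, c) \<notin> parcs G" "(b, d) \<notin> parcs G"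
        "(c, a) \<notin> parcs G" "(d, a) \<notin> parcs G" "(c, b) \<notin> parcs G" "(d, b) \<notin> parcs G"
        using S by blast+
      \<comment> \<open>A common end of the two edges would turn one of them into one of the
        excluded arcs.\<close>
      have ne: "a \<noteq> b" "a \<noteq> c" "a \<noteq> d" "b \<noteq> c" "b \<noteq> d" "c \<noteq> d"
        using ab cd non L S by blast+
      have "\<not> induced_free two_K2 G"
        by (rule not_induced_freeI[OF G pair_graph_two_K2, where f = "\<lambda>i. [a, b, c, d] ! i"])
           (use ab cd S[OF ab] S[OF cd] non ne L W[OF ab] W[OF cd] in
             \<open>simp_all add: two_K2_def inj_on_def, safe, simp_all\<close>)
      with assms(2) show False by blast
    qed
  qed (use S L in auto)
qed

text \<open>An entry that keeps the color contributes no arc, hence the inequality of lengths.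
  Extensionality survives each step, since only vertices of \<open>G\<close> are recolored, and
  keeps the walk inside \<open>colorings\<close>.\<close>

lemma recoloring_imp_awalk:
  assumes G: "pair_graph G" and "simple_graph (\<lambda>x y. (x, y) \<in> parcs G)"
    and "simple_graph.recoloring (\<lambda>x y. (x, y) \<in> parcs G) k (pverts G) c vs d"
    and "c \<in> extensional (pverts G)"
  shows "\<exists>p. pre_digraph.awalk (with_proj (recoloring_graph k G)) c p d \<and> length p \<le> length vs"
proof -
  interpret simple_graph "\<lambda>x y. (x, y) \<in> parcs G" by fact
  interpret G: pair_graph G by fact
  interpret R: pair_graph "recoloring_graph k G" using G by (rule pair_graph_recoloring_graph)
  have col: "c \<in> colorings k G" if "proper k (pverts G) c" "c \<in> extensional (pverts G)" for c
    using that G.wellformed' unfolding proper_def colorings_def PiE_iff by fastforce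
  show ?thesis using assms(3,4)
  proof (induction rule: recoloring.induct)
    case (Nil c)
    then have "c \<in> pverts (recoloring_graph k G)" using col by (simp add: recoloring_graph_def)
    then show ?case by (intro exI[of _ "[]"]) (simp add: R.awalk_Nil_iff)
  next
    case (Cons c v x vs d)
    have ext: "c(v := x) \<in> extensional (pverts G)"
      using Cons.prems Cons.hyps(2) by (auto simp: extensional_def)
    from Cons.IH[OF ext] obtain p where p: "R.awalk (c(v := x)) p d" "length p \<le> length vs"
      by blast
    show ?case
    proof (cases "x = c v")
      case True
      then show ?thesis using p by (intro exI[of _ p]) auto
    next
      case False
      have "{w \<in> pverts G. c w \<noteq> (c(v := x)) w} = {v}" using False Cons.hyps(2) by auto
      then have "(c, c(v := x)) \<in> parcs (recoloring_graph k G)"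
        using col[OF Cons.hyps(1) Cons.prems] col[OF recoloring_proper[OF Cons.hyps(3)] ext]
        by (simp add: recoloring_graph_def)
      then have "R.awalk c ((c, c(v := x)) # p) d" using p(1) R.wellformed'
        by (auto simp: R.awalk_Cons_iff)
      then show ?thesis using p(2) by (intro exI[of _ "(c, c(v := x)) # p"]) auto
    qed
  qed
qed

theorem theorem10:
  fixes G :: "'a pair_pre_digraph" and n :: nat
  assumes "pair_graph G"
    and "card (pverts G) = n"
    and "induced_free two_K2 G"
    and "induced_free triangle_graph G"
  shows "recolorable G \<and>
    (\<forall>l \<ge> chromatic_number G + 1. graph_diameter (recoloring_graph l G) \<le> ereal (2 * real n ^ 2))"
proof -
  interpret G: pair_graph G by fact
  interpret two_K2_triangle_free "\<lambda>x y. (x, y) \<in> parcs G"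
    using assms by (intro two_K2_triangle_free_parcs)
  have col: "proper k (pverts G) c" if "c \<in> colorings k G" for k c
    using that unfolding proper_def colorings_def PiE_iff by fastforce
  have short: "\<exists>p. pre_digraph.awalk (with_proj (recoloring_graph l G)) c p d \<and> length p \<le> 2 * n ^ 2"
    if l: "l \<ge> chromatic_number G + 1" and c: "c \<in> colorings l G" and d: "d \<in> colorings l G" for l c d
  proof -
    have "recolorable_within l (pverts G) (\<lambda>_. 2 * n)"
    \<comment> \<open>For \<open>l = 1\<close> the chromatic number is 0 and \<open>G\<close> has no
      vertices; otherwise \<open>l - 1\<close> satisfies the condition \<open>1 \<le> k\<close> of
      \<open>recolorable_within_twice_card\<close>.\<close>
    proof (cases "l = 1")
      case True
      obtain f where "f \<in> colorings 0 G"
        using colorings_nonempty[OF assms(1), of 0] l True by auto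
      then have "pverts G = {}" unfolding colorings_def PiE_iff by auto
      then show ?thesis by (simp add: recolorable_within_empty)
    next
      case False
      then have l': "l = Suc (l - 1)" "1 \<le> l - 1" using l by auto
      obtain f where "f \<in> colorings (l - 1) G"
        using colorings_nonempty[OF assms(1), of "l - 1"] l by fastforce
      from recolorable_within_twice_card[OF G.pair_finite_verts col[OF this] l'(2)]
      show ?thesis using l'(1) assms(2) by simp
    qed
    \<comment> \<open>Extensional functions share the value \<open>undefined\<close> outside the
      vertices.\<close>
    moreover have "\<forall>w. w \<notin> pverts G \<longrightarrow> c w = d w"
      using c d unfolding colorings_def by (auto simp: PiE_iff extensional_def)
    ultimately obtain vs where vs: "recoloring l (pverts G) c vs d"
      "\<forall>w\<in>pverts G. count_list vs w \<le> 2 * n"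
      using col[OF c] col[OF d] unfolding recolorable_within_def by blast
    \<comment> \<open>There are \<open>n\<close> vertices with at most \<open>2 * n\<close> entries
      each.\<close>
    have "length vs = sum (count_list vs) (pverts G)"
      using sum_count_set[OF recoloring_set[OF vs(1)] G.pair_finite_verts] by simp
    also have "\<dots> \<le> card (pverts G) * (2 * n)"
      using sum_bounded_above[of "pverts G" "count_list vs" "2 * n"] vs(2) by auto
    finally have "length vs \<le> 2 * n ^ 2" using assms(2) by (simp add: power2_eq_square)
    moreover have "c \<in> extensional (pverts G)" using c unfolding colorings_def PiE_iff by auto
    ultimately show ?thesis
      using recoloring_imp_awalk[OF assms(1) simple_graph_axioms vs(1)] by fastforce
  qed
  have "Digraph_Component.connected (with_proj (recoloring_graph l G))"
    and "graph_diameter (recoloring_graph l G) \<le> ereal (2 * real n ^ 2)"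
    if l: "l \<ge> chromatic_number G + 1" for l
  proof -
    interpret R: pair_graph "recoloring_graph l G" using assms(1) by (rule pair_graph_recoloring_graph)
    have V: "pverts (recoloring_graph l G) = colorings l G" by (simp add: recoloring_graph_def)
    have "pverts (recoloring_graph l G) \<noteq> {}"
      using colorings_nonempty[OF assms(1), of l] l V by auto
    moreover have "reachable (with_proj (recoloring_graph l G)) c d"
      if "c \<in> pverts (recoloring_graph l G)" "d \<in> pverts (recoloring_graph l G)" for c d
      using short[OF l] that unfolding V R.reachable_awalk by blast
    \<comment> \<open>\<open>connected\<close> refers to the symmetric closure, to which
      reachability carries over.\<close>
    ultimately show "Digraph_Component.connected (with_proj (recoloring_graph l G))"
      unfolding connected_def
      by (intro strongly_connectedI) (auto intro: R.reachable_mk_symmetricI)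
    have "R.\<mu> (\<lambda>_. 1) c d \<le> ereal (2 * real n ^ 2)"
      if "c \<in> pverts (recoloring_graph l G)" "d \<in> pverts (recoloring_graph l G)" for c d
    proof -
      obtain p where p: "R.awalk c p d" "length p \<le> 2 * n ^ 2"
        using short[OF l] \<open>c \<in> _\<close> \<open>d \<in> _\<close> unfolding V by blast
      have "R.\<mu> (\<lambda>_. 1) c d \<le> ereal (R.awalk_cost (\<lambda>_. 1) p)"
        using p(1) by (rule R.min_cost_le_walk_cost)
      also have "R.awalk_cost (\<lambda>_. 1) p = real (length p)"
        by (induction p) auto
      also have "ereal (real (length p)) \<le> ereal (real (2 * n ^ 2))"
        using p(2) by (simp only: ereal_less_eq of_nat_le_iff)
      finally show ?thesis by simp
    qed
    then show "graph_diameter (recoloring_graph l G) \<le> ereal (2 * real n ^ 2)"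
      unfolding graph_diameter_def by (intro SUP_least) auto
  qed
  then show ?thesis unfolding recolorable_def by blast
qed

end
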